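(* Let $k \leq n$ be positive integers that are powers of $2$ and let $0 < p < 1$. There exists a constant $\varepsilon_0 > 0$ such that any non-adaptive algorithm which, given query access to a function $f\colon [n] \to \mathbb{R}$ that is $\varepsilon_0$-far from $(12\dots k)$-free, outputs a length-$k$ monotone subsequence with probability at least $p$, must make at least $p \binom{\log_2 n}{\log_2 k}$ queries. Moreover, one can take $\varepsilon_0 = 1/k$.
   Context: $[n]=\{1,\dots,n\}$. A length-$k$ monotone subsequence of $f$ is a tuple $(i_1,\dots,i_k)$ with $i_1<\dots<i_k$ and $f(i_1)<\dots<f(i_k)$; $f$ is $(12\dots k)$-free if it has none, and $\varepsilon$-far from $(12\dots k)$-free if every $(12\dots k)$-free $g\colon[n]\to\mathbb{R}$ satisfies $\Pr_{i\sim[n]}[f(i)\ne g(i)]\ge\varepsilon$ for uniform $i$. A non-adaptive algorithm chooses its queries independently of the answers to previous queries.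
   Formalization: The algorithm counts as successful only if the length-k monotone subsequence it outputs consists of queried positions; otherwise the claim fails, e.g. for k = 1 the output (1) is always correct with no query, while the bound is p > 0. *)

theory Defs
  imports "HOL-Probability.Probability"
begin

text \<open>
  A function \<open>f\<close> from \<open>[n]\<close> to the reals is a map \<open>f :: nat \<Rightarrow> real\<close> of which only the values on
  \<open>{1..n}\<close> matter.  Tuples of indices are lists.
\<close>

definition monotone_subseq :: "nat \<Rightarrow> nat \<Rightarrow> (nat \<Rightarrow> real) \<Rightarrow> nat list \<Rightarrow> bool" where
  "monotone_subseq n k f is \<longleftrightarrow>
     length is = k \<and> set is \<subseteq> {1..n} \<and> sorted_wrt (<) is \<and> sorted_wrt (<) (map f is)"

definition monotone_free :: "nat \<Rightarrow> nat \<Rightarrow> (nat \<Rightarrow> real) \<Rightarrow> bool" where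
  "monotone_free n k f \<longleftrightarrow> (\<nexists>is. monotone_subseq n k f is)"

definition far_from_free :: "nat \<Rightarrow> nat \<Rightarrow> real \<Rightarrow> (nat \<Rightarrow> real) \<Rightarrow> bool" where
  "far_from_free n k \<epsilon> f \<longleftrightarrow>
     (\<forall>g. monotone_free n k g \<longrightarrow>
        measure_pmf.prob (pmf_of_set {1..n}) {i. f i \<noteq> g i} \<ge> \<epsilon>)"

text \<open>
  A randomized non-adaptive algorithm draws its whole list of queries before seeing any answer,
  and then, from the queries and the list of answers only, produces a possibly randomized output.
  Since queries and outputs range over a countable type, the law of the queries together with
  the conditional law of the output, both discrete, describe every such algorithm, whatever
  source of randomness it uses.  Failure is represented by any output that is not a
  monotone subsequence, for instance the empty list.
\<close>

record nonadaptive_algorithm =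
  queries :: "nat list pmf"
  report :: "nat list \<Rightarrow> real list \<Rightarrow> nat list pmf"

definition queries_domain :: "nat \<Rightarrow> nonadaptive_algorithm \<Rightarrow> bool" where
  "queries_domain n A \<longleftrightarrow> (\<forall>qs \<in> set_pmf (queries A). set qs \<subseteq> {1..n})"

definition makes_at_most :: "nonadaptive_algorithm \<Rightarrow> nat \<Rightarrow> bool" where
  "makes_at_most A q \<longleftrightarrow> (\<forall>qs \<in> set_pmf (queries A). length qs \<le> q)"

definition run :: "nonadaptive_algorithm \<Rightarrow> (nat \<Rightarrow> real) \<Rightarrow> (nat list \<times> nat list) pmf" where
  "run A f = do {
     qs \<leftarrow> queries A;
     is \<leftarrow> report A qs (map f qs);
     return_pmf (qs, is)
   }"

text \<open>
  The reported subsequence has to be found among the queried positions.  Were unqueried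
  positions allowed, then for \<open>k = 1\<close> the output \<open>(1)\<close> and, for functions far from free and
  \<open>k = n\<close>, the output \<open>(1, ..., n)\<close> would always be correct without a single query.
\<close>

definition success_prob :: "nat \<Rightarrow> nat \<Rightarrow> nonadaptive_algorithm \<Rightarrow> (nat \<Rightarrow> real) \<Rightarrow> real" where
  "success_prob n k A f =
     measure_pmf.prob (run A f) {(qs, is). monotone_subseq n k f is \<and> set is \<subseteq> set qs}"

definition finds_monotone :: "nat \<Rightarrow> nat \<Rightarrow> real \<Rightarrow> real \<Rightarrow> nonadaptive_algorithm \<Rightarrow> bool" where
  "finds_monotone n k \<epsilon> p A \<longleftrightarrow>
     (\<forall>f. far_from_free n k \<epsilon> f \<longrightarrow> success_prob n k A f \<ge> p)"

text \<open>
  Lower bound \<open>b\<close> on the worst-case number of queries.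
\<close>

definition query_lower_bound :: "nat \<Rightarrow> nat \<Rightarrow> real \<Rightarrow> real \<Rightarrow> real \<Rightarrow> bool" where
  "query_lower_bound n k \<epsilon> p b \<longleftrightarrow>
     (\<forall>A q. queries_domain n A \<and> makes_at_most A q \<and> finds_monotone n k \<epsilon> p A
        \<longrightarrow> b \<le> real q)"

end

theory Submission
  imports Defs
begin

text \<open>
  Write \<open>n = 2\<^sup>a\<close>, \<open>k = 2\<^sup>b\<close> and view positions as strings of \<open>a\<close> bits.  For a set \<open>S\<close> of \<open>b\<close> bit
  positions let \<open>f\<^sub>S\<close> complement the bits outside \<open>S\<close>.  Two positions are in increasing order under
  \<open>f\<^sub>S\<close> iff their most significant differing bit lies in \<open>S\<close>.  Hence the \<open>n/k\<close> classes of positions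
  agreeing outside \<open>S\<close> are disjoint increasing subsequences of length \<open>k\<close>, so \<open>f\<^sub>S\<close> is \<open>1/k\<close>-far
  from free; and an increasing subsequence of length \<open>k\<close> must branch in full at each bit of \<open>S\<close>.
  The sets \<open>S\<close> for which a query set \<open>Q\<close> contains such a fully branching subset are at most
  \<open>card Q\<close> many, by splitting \<open>Q\<close> at the top bit and
  \<open>card (A \<union> B) + card (A \<inter> B) = card A + card B\<close>.  Averaging over the \<open>a choose b\<close> sets \<open>S\<close>
  gives the bound.
\<close>

text \<open>Positions are numbered from 1, so the top bit of \<open>x\<close> in \<open>{1..2 ^ Suc a}\<close> is set iff \<open>x > 2 ^ a\<close>.\<close>

primrec flip :: "nat \<Rightarrow> nat set \<Rightarrow> nat \<Rightarrow> real" where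
  "flip 0 S x = 0"
| "flip (Suc a) S x =
     (if x \<le> 2 ^ a then flip a S x + (if a \<in> S then 0 else 2 ^ a)
      else flip a S (x - 2 ^ a) + (if a \<in> S then 2 ^ a else 0))"

definition lower :: "nat \<Rightarrow> nat set \<Rightarrow> nat set" where
  "lower a Q = {x \<in> {1..2 ^ a}. x \<in> Q}"

text \<open>Shifted down by \<open>2 ^ a\<close>, so that both halves are again sets of positions
  with \<open>a\<close> bits and inductions on \<open>a\<close> apply to each.\<close>

definition upper :: "nat \<Rightarrow> nat set \<Rightarrow> nat set" where
  "upper a Q = {x \<in> {1..2 ^ a}. x + 2 ^ a \<in> Q}"

text \<open>A recursive form of "\<open>Q\<close> contains a fully branching subset for
  \<open>S\<close>": a bit outside \<open>S\<close> asks for such a subset in one half, a bit in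
  \<open>S\<close> for one in each half. The link to \<open>flip\<close> is
  \<open>captured_if_strict_mono_on\<close>.\<close>

primrec captured :: "nat \<Rightarrow> nat set \<Rightarrow> nat set set" where
  "captured 0 Q = (if Q = {} then {} else {{}})"
| "captured (Suc a) Q =
     captured a (lower a Q) \<union> captured a (upper a Q) \<union>
     insert a ` (captured a (lower a Q) \<inter> captured a (upper a Q))"

section \<open>Range of \<open>flip\<close> and splitting at the top bit\<close>

lemma flip_nonneg: "0 \<le> flip a S x"
  by (induction a arbitrary: x) auto

lemma flip_less: "flip a S x < 2 ^ a"
proof (induction a arbitrary: x)
  case (Suc a)
  show ?case using Suc[of x] Suc[of "x - 2 ^ a"] zero_less_power[of "2::real" a]
    by (auto simp del: zero_less_power)
qed simp

lemma split_top:
  assumes "Q \<subseteq> {1..2 ^ Suc a}"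
  shows "Q = lower a Q \<union> (\<lambda>x. x + 2 ^ a) ` upper a Q" (is "Q = ?R")
proof
  show "Q \<subseteq> ?R"
  proof
    fix x assume x: "x \<in> Q"
    show "x \<in> ?R"
    proof (cases "x \<le> 2 ^ a")
      case True then show ?thesis using x assms by (auto simp: lower_def)
    next
      case False
      then have "x - 2 ^ a \<in> upper a Q" "x = x - 2 ^ a + 2 ^ a"
        using x assms by (auto simp: upper_def)
      then show ?thesis by blast
    qed
  qed
qed (auto simp: lower_def upper_def)

lemma lower_subset: "lower a Q \<subseteq> {1..2 ^ a}" and upper_subset: "upper a Q \<subseteq> {1..2 ^ a}"
  by (auto simp: lower_def upper_def)

lemma finite_lower [simp]: "finite (lower a Q)" and finite_upper [simp]: "finite (upper a Q)"
  by (simp_all add: lower_def upper_def)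

lemma card_split_top:
  assumes "Q \<subseteq> {1..2 ^ Suc a}"
  shows "card Q = card (lower a Q) + card (upper a Q)"
proof -
  have "card Q = card (lower a Q \<union> (\<lambda>x. x + 2 ^ a) ` upper a Q)"
    using split_top[OF assms] by simp
  also have "\<dots> = card (lower a Q) + card ((\<lambda>x. x + 2 ^ a) ` upper a Q)"
    by (rule card_Un_disjoint) (auto simp: lower_def upper_def)
  also have "card ((\<lambda>x. x + 2 ^ a) ` upper a Q) = card (upper a Q)"
    by (rule card_image) (simp add: inj_on_def)
  finally show ?thesis .
qed

section \<open>Counting captured bit sets\<close>

lemma finite_captured [simp]: "finite (captured a Q)"
  by (induction a arbitrary: Q) auto

lemma card_captured_le:
  assumes "Q \<subseteq> {1..2 ^ a}"
  shows "card (captured a Q) \<le> card Q"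
  using assms
proof (induction a arbitrary: Q)
  case 0
  then have "finite Q" using finite_subset by blast
  then show ?case by (auto simp: Suc_le_eq card_gt_0_iff)
next
  case (Suc a)
  let ?L = "captured a (lower a Q)" and ?U = "captured a (upper a Q)"
  have "card (captured (Suc a) Q) \<le> card (?L \<union> ?U) + card (insert a ` (?L \<inter> ?U))"
    unfolding captured.simps by (rule card_Un_le)
  also have "\<dots> \<le> card (?L \<union> ?U) + card (?L \<inter> ?U)"
    by (intro add_left_mono card_image_le finite_Int) simp
  also have "\<dots> = card ?L + card ?U"
    by (rule card_Un_Int[symmetric]) simp_all
  also have "\<dots> \<le> card (lower a Q) + card (upper a Q)"
    by (intro add_mono Suc.IH lower_subset upper_subset)
  finally show ?case using card_split_top[OF Suc.prems] by simp
qed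

section \<open>Increasing sets of \<open>flip\<close> are captured\<close>

lemma strict_mono_on_lower:
  assumes "strict_mono_on T (flip (Suc a) S)"
  shows "strict_mono_on (lower a T) (flip a S)"
proof (rule strict_mono_onI)
  fix x y assume "x \<in> lower a T" "y \<in> lower a T" "x < y"
  then show "flip a S x < flip a S y"
    using strict_mono_onD[OF assms, of x y] by (auto simp: lower_def)
qed

lemma strict_mono_on_upper:
  assumes "strict_mono_on T (flip (Suc a) S)"
  shows "strict_mono_on (upper a T) (flip a S)"
proof (rule strict_mono_onI)
  fix x y assume "x \<in> upper a T" "y \<in> upper a T" "x < y"
  then show "flip a S x < flip a S y"
    using strict_mono_onD[OF assms, of "x + 2 ^ a" "y + 2 ^ a"] by (auto simp: upper_def)
qed

text \<open>Complementing the top bit puts the values on the lower half at \<open>2 ^ a\<close> or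
  above and those on the upper half below it, so any pair across the halves decreases.\<close>

lemma lower_or_upper_empty:
  assumes "strict_mono_on T (flip (Suc a) S)" "a \<notin> S"
  shows "lower a T = {} \<or> upper a T = {}"
proof (rule ccontr)
  assume "\<not> ?thesis"
  then obtain x y where x: "x \<in> lower a T" and y: "y \<in> upper a T" by blast
  then have "flip (Suc a) S x < flip (Suc a) S (y + 2 ^ a)"
    by (intro strict_mono_onD[OF assms(1)]) (auto simp: lower_def upper_def)
  moreover have "x \<le> 2 ^ a" "y > 0" using x y by (auto simp: lower_def upper_def)
  ultimately show False
    using flip_less[of a S y] flip_nonneg[of a S x] assms(2) by simp
qed

lemma Int_lessThan_Suc: "S \<inter> {..<Suc a} = (if a \<in> S then insert a (S \<inter> {..<a}) else S \<inter> {..<a})"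
  by (auto simp: less_Suc_eq)

text \<open>A top bit in \<open>S\<close> at most doubles the size; a top bit outside
  \<open>S\<close> leaves only one half nonempty.\<close>

lemma card_strict_mono_on_flip:
  assumes "T \<subseteq> {1..2 ^ a}" "strict_mono_on T (flip a S)"
  shows "card T \<le> 2 ^ card (S \<inter> {..<a})"
  using assms
proof (induction a arbitrary: T)
  case 0
  then have "card T \<le> card {1::nat}" by (intro card_mono) auto
  then show ?case by simp
next
  case (Suc a)
  note L = Suc.IH[OF lower_subset strict_mono_on_lower[OF Suc.prems(2)]]
  note U = Suc.IH[OF upper_subset strict_mono_on_upper[OF Suc.prems(2)]]
  show ?case
  proof (cases "a \<in> S")
    case True
    then show ?thesis using L U card_split_top[OF Suc.prems(1)] by (simp add: Int_lessThan_Suc)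
  next
    case False
    then show ?thesis
      using L U card_split_top[OF Suc.prems(1)] lower_or_upper_empty[OF Suc.prems(2) False]
      by (auto simp: Int_lessThan_Suc)
  qed
qed

lemma captured_if_strict_mono_on:
  assumes "T \<subseteq> {1..2 ^ a}" "T \<subseteq> Q" "strict_mono_on T (flip a S)"
    and "card T = 2 ^ card (S \<inter> {..<a})"
  shows "S \<inter> {..<a} \<in> captured a Q"
  using assms
proof (induction a arbitrary: T Q)
  case 0
  then show ?case by auto
next
  case (Suc a)
  have sub: "lower a T \<subseteq> lower a Q" "upper a T \<subseteq> upper a Q"
    using Suc.prems(2) by (auto simp: lower_def upper_def)
  note mono = strict_mono_on_lower[OF Suc.prems(3)] strict_mono_on_upper[OF Suc.prems(3)]
  note IH = Suc.IH[OF lower_subset sub(1) mono(1)] Suc.IH[OF upper_subset sub(2) mono(2)]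
  note card = card_split_top[OF Suc.prems(1)]
  show ?case
  proof (cases "a \<in> S")
    case True
    have "card T = 2 * 2 ^ card (S \<inter> {..<a})"
      using Suc.prems(4) True by (simp add: Int_lessThan_Suc)
    \<comment> \<open>Neither half can exceed half of \<open>card T\<close>, so both attain their
      maximum and the induction hypothesis captures the same set in each.\<close>
    then have "card (lower a T) = 2 ^ card (S \<inter> {..<a})" "card (upper a T) = 2 ^ card (S \<inter> {..<a})"
      using card card_strict_mono_on_flip[OF lower_subset mono(1)]
        card_strict_mono_on_flip[OF upper_subset mono(2)] by linarith+
    then show ?thesis using IH True by (simp add: Int_lessThan_Suc)
  next
    case False
    then show ?thesis
      using IH card Suc.prems(4) lower_or_upper_empty[OF Suc.prems(3) False]
      by (auto simp: Int_lessThan_Suc)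
  qed
qed

section \<open>Sets hitting every largest increasing set\<close>

lemma strict_mono_on_flip_lift:
  assumes "L \<subseteq> {1..2 ^ a}" "U \<subseteq> {1..2 ^ a}"
    and "strict_mono_on L (flip a S)" "strict_mono_on U (flip a S)"
    and "a \<in> S \<or> L = {} \<or> U = {}"
  shows "strict_mono_on (L \<union> (\<lambda>x. x + 2 ^ a) ` U) (flip (Suc a) S)"
proof (rule strict_mono_onI)
  fix x y assume xy: "x \<in> L \<union> (\<lambda>x. x + 2 ^ a) ` U" "y \<in> L \<union> (\<lambda>x. x + 2 ^ a) ` U" "x < y"
  consider "x \<in> L" "y \<in> L" | u where "x \<in> L" "u \<in> U" "y = u + 2 ^ a"
    | u v where "u \<in> U" "v \<in> U" "x = u + 2 ^ a" "y = v + 2 ^ a"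
    | u where "u \<in> U" "y \<in> L" "x = u + 2 ^ a"
    using xy by auto
  then show "flip (Suc a) S x < flip (Suc a) S y"
  proof cases
    case 1
    then have "x \<le> 2 ^ a" "y \<le> 2 ^ a" using assms(1) by auto
    then show ?thesis using strict_mono_onD[OF assms(3) 1 xy(3)] by simp
  next
    case 2
    \<comment> \<open>Both halves are nonempty here, which forces \<open>a \<in> S\<close>; the
      values then lie on opposite sides of \<open>2 ^ a\<close>.\<close>
    then have "x \<le> 2 ^ a" "u > 0" "a \<in> S" using assms by fastforce+
    then show ?thesis using 2 flip_less[of a S x] flip_nonneg[of a S u] by simp
  next
    case 3
    then have "u > 0" "v > 0" using assms(2) by fastforce+
    then show ?thesis using 3 strict_mono_onD[OF assms(4) 3(1,2)] xy(3) by simp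
  next
    case 4
    then have "y \<le> 2 ^ a" using assms(1) by auto
    then show ?thesis using 4 xy(3) by simp
  qed
qed

text \<open>Counting form of the existence of \<open>2 ^ a / 2 ^ card (S \<inter> {..<a})\<close>
  disjoint increasing sets of full size, proved by induction on the bits without naming these
  sets.\<close>

lemma hitting_set_card:
  assumes "D \<subseteq> {1..2 ^ a}"
    and "\<And>T. T \<subseteq> {1..2 ^ a} \<Longrightarrow> strict_mono_on T (flip a S) \<Longrightarrow>
          card T = 2 ^ card (S \<inter> {..<a}) \<Longrightarrow> T \<inter> D \<noteq> {}"
  shows "2 ^ a \<le> card D * 2 ^ card (S \<inter> {..<a})"
  using assms
proof (induction a arbitrary: D)
  case 0
  have "{1} \<inter> D \<noteq> {}" by (rule "0.prems"(2)) (auto simp: strict_mono_on_def)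
  moreover have "finite D" using "0.prems"(1) finite_subset by blast
  ultimately show ?case by (auto simp: Suc_le_eq card_gt_0_iff)
next
  case (Suc a)
  define P where "P T \<longleftrightarrow> T \<subseteq> {1..2 ^ a} \<and> strict_mono_on T (flip a S) \<and>
    card T = 2 ^ card (S \<inter> {..<a})" for T
  have IH: "2 ^ a \<le> card D' * 2 ^ card (S \<inter> {..<a})"
    if "D' \<subseteq> {1..2 ^ a}" "\<And>T. P T \<Longrightarrow> T \<inter> D' \<noteq> {}" for D'
    using Suc.IH[of D'] that by (auto simp: P_def)
  let ?up = "\<lambda>x::nat. x + 2 ^ a"
  have card_up: "card (?up ` U) = card U" for U
    by (rule card_image) (simp add: inj_on_def)
  have sub_up: "L \<union> ?up ` U \<subseteq> {1..2 ^ Suc a}" if "L \<subseteq> {1..2 ^ a}" "U \<subseteq> {1..2 ^ a}" for L U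
    using that by fastforce
  have disj: "L \<inter> lower a D \<noteq> {} \<or> U \<inter> upper a D \<noteq> {}"
    if "L \<subseteq> {1..2 ^ a}" "U \<subseteq> {1..2 ^ a}" "(L \<union> ?up ` U) \<inter> D \<noteq> {}" for L U
    using that by (fastforce simp: lower_def upper_def)
  show ?case
  proof (cases "a \<in> S")
    case True
    \<comment> \<open>Sets \<open>L\<close> and \<open>U\<close> missed by the two halves of
      \<open>D\<close> would combine to a set of full size missed by \<open>D\<close>. One half of
      \<open>D\<close> therefore meets the bound already, and the extra factor 2 on the left is
      matched by the new bit of \<open>S\<close> on the right.\<close>
    have "(\<forall>L. P L \<longrightarrow> L \<inter> lower a D \<noteq> {}) \<or> (\<forall>U. P U \<longrightarrow> U \<inter> upper a D \<noteq> {})"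
    proof (rule ccontr)
      assume "\<not> ?thesis"
      then obtain L U where LU: "P L" "P U" "L \<inter> lower a D = {}" "U \<inter> upper a D = {}" by blast
      have sub: "L \<subseteq> {1..2 ^ a}" "U \<subseteq> {1..2 ^ a}" using LU by (auto simp: P_def)
      then have "finite L" "finite U" using finite_subset by blast+
      moreover have "L \<inter> ?up ` U = {}" using sub by fastforce
      ultimately have "card (L \<union> ?up ` U) = card L + card (?up ` U)"
        by (simp add: card_Un_disjoint)
      then have "(L \<union> ?up ` U) \<inter> D \<noteq> {}"
        using LU True by (intro Suc.prems(2) strict_mono_on_flip_lift sub_up)
          (auto simp: P_def card_up Int_lessThan_Suc)
      then show False using disj[of L U] LU by (auto simp: P_def)
    qed
    then have "2 ^ a \<le> card (lower a D) * 2 ^ card (S \<inter> {..<a}) \<or>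
        2 ^ a \<le> card (upper a D) * 2 ^ card (S \<inter> {..<a})"
      using IH lower_subset upper_subset by meson
    then have "2 ^ a \<le> card D * 2 ^ card (S \<inter> {..<a})"
      unfolding card_split_top[OF Suc.prems(1)] add_mult_distrib by linarith
    then show ?thesis using True by (simp add: Int_lessThan_Suc)
  next
    case False
    \<comment> \<open>A set of full size in one half, joined with the empty set in the other, has
      full size for the whole. Each half of \<open>D\<close> thus hits everything in its own half,
      and the two bounds add up.\<close>
    have "T \<inter> lower a D \<noteq> {}" if "P T" for T
    proof -
      have "(T \<union> ?up ` {}) \<inter> D \<noteq> {}"
        using that False by (intro Suc.prems(2) strict_mono_on_flip_lift sub_up)
          (auto simp: P_def Int_lessThan_Suc)
      then show ?thesis using disj[of T "{}"] that by (auto simp: P_def)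
    qed
    moreover have "T \<inter> upper a D \<noteq> {}" if "P T" for T
    proof -
      have "({} \<union> ?up ` T) \<inter> D \<noteq> {}"
        using that False by (intro Suc.prems(2) strict_mono_on_flip_lift sub_up)
          (auto simp: P_def Int_lessThan_Suc card_up)
      then show ?thesis using disj[of "{}" T] that by (auto simp: P_def)
    qed
    ultimately have "2 ^ a \<le> card (lower a D) * 2 ^ card (S \<inter> {..<a})"
      "2 ^ a \<le> card (upper a D) * 2 ^ card (S \<inter> {..<a})"
      using IH lower_subset upper_subset by meson+
    then show ?thesis
      using False by (simp add: card_split_top[OF Suc.prems(1)] Int_lessThan_Suc add_mult_distrib)
  qed
qed

section \<open>From index lists to sets, and the distance from free\<close>

lemma monotone_subseqD:
  assumes "monotone_subseq n k f is"
  shows "set is \<subseteq> {1..n}" "strict_mono_on (set is) f" "card (set is) = k"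
proof -
  have srt: "sorted_wrt (<) is" and fsrt: "sorted_wrt (\<lambda>x y. f x < f y) is"
    and rest: "set is \<subseteq> {1..n}" "length is = k"
    using assms by (auto simp: monotone_subseq_def sorted_wrt_map)
  then show "set is \<subseteq> {1..n}" "card (set is) = k"
    by (auto simp: strict_sorted_iff distinct_card)
  show "strict_mono_on (set is) f"
  proof (rule strict_mono_onI)
    fix x y assume "x \<in> set is" "y \<in> set is" "x < y"
    then obtain i j where ij: "i < length is" "j < length is" "x = is ! i" "y = is ! j"
      by (auto simp: in_set_conv_nth)
    have "i < j"
    proof (rule ccontr)
      assume "\<not> i < j"
      then have "is ! j \<le> is ! i"
        using sorted_wrt_nth_less[OF srt, of j i] ij by (cases "i = j") auto
      then show False using ij \<open>x < y\<close> by simp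
    qed
    then show "f x < f y" using sorted_wrt_nth_less[OF fsrt] ij by simp
  qed
qed

lemma monotone_subseq_sorted_list_of_set:
  assumes "T \<subseteq> {1..n}" "strict_mono_on T f" "card T = k"
  shows "monotone_subseq n k f (sorted_list_of_set T)"
proof -
  have fin: "finite T" using assms(1) finite_subset by blast
  have "sorted_wrt (\<lambda>x y. f x < f y) (sorted_list_of_set T)"
    by (rule sorted_wrt_mono_rel[OF _ strict_sorted_list_of_set])
      (use fin assms(2) in \<open>auto dest: strict_mono_onD\<close>)
  then show ?thesis
    using fin assms by (simp add: monotone_subseq_def sorted_wrt_map)
qed

text \<open>An increasing set of size \<open>2 ^ card S\<close> on which \<open>g\<close> agrees
  with \<open>flip a S\<close> would be increasing for \<open>g\<close> too. So the positions where
  they differ form a hitting set.\<close>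

lemma far_from_free_flip:
  assumes "S \<subseteq> {..<a}"
  shows "far_from_free (2 ^ a) (2 ^ card S) (1 / 2 ^ card S) (flip a S)"
  unfolding far_from_free_def
proof (intro allI impI)
  fix g :: "nat \<Rightarrow> real" assume free: "monotone_free (2 ^ a) (2 ^ card S) g"
  have S: "S \<inter> {..<a} = S" using assms by blast
  define D where "D = {1..2 ^ a} \<inter> {i. flip a S i \<noteq> g i}"
  have "2 ^ a \<le> card D * 2 ^ card (S \<inter> {..<a})"
  proof (rule hitting_set_card)
    fix T :: "nat set"
    assume T: "T \<subseteq> {1..2 ^ a}" "strict_mono_on T (flip a S)" "card T = 2 ^ card (S \<inter> {..<a})"
    show "T \<inter> D \<noteq> {}"
    proof
      assume "T \<inter> D = {}"
      then have "flip a S x = g x" if "x \<in> T" for x using T(1) that by (auto simp: D_def)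
      then have "strict_mono_on T g" using T(2) by (simp add: strict_mono_on_def)
      then show False
        using monotone_subseq_sorted_list_of_set[OF T(1)] T(3) free S
        by (auto simp: monotone_free_def)
    qed
  qed (simp add: D_def)
  then have "real (2 ^ a) \<le> real (card D * 2 ^ card S)" unfolding S of_nat_le_iff .
  then show "1 / 2 ^ card S \<le> measure_pmf.prob (pmf_of_set {1..2 ^ a}) {i. flip a S i \<noteq> g i}"
    by (simp add: measure_pmf_of_set D_def field_simps)
qed

section \<open>Success probabilities and averaging\<close>

text \<open>Success forces the queries to capture \<open>S\<close>. Non-adaptivity enters here: the
  law of the queries is the same for every input, so the events for different \<open>S\<close> live
  on one probability space.\<close>

lemma success_prob_flip_le:
  assumes "S \<subseteq> {..<a}"
  shows "success_prob (2 ^ a) (2 ^ card S) A (flip a S)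
    \<le> measure_pmf.prob (queries A) {qs. S \<in> captured a (set qs)}"
proof -
  have S: "S \<inter> {..<a} = S" using assms by blast
  have fst: "map_pmf fst (run A (flip a S)) = queries A"
    by (simp add: run_def map_bind_pmf bind_return_pmf')
  have "S \<in> captured a (set qs)"
    if "monotone_subseq (2 ^ a) (2 ^ card S) (flip a S) is" "set is \<subseteq> set qs" for qs "is"
    using captured_if_strict_mono_on[OF monotone_subseqD(1)[OF that(1)] that(2)
        monotone_subseqD(2)[OF that(1)]] monotone_subseqD(3)[OF that(1)] S by simp
  then have "success_prob (2 ^ a) (2 ^ card S) A (flip a S)
    \<le> measure_pmf.prob (run A (flip a S)) (fst -` {qs. S \<in> captured a (set qs)})"
    unfolding success_prob_def
    by (intro measure_pmf.finite_measure_mono) auto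
  also have "\<dots> = measure_pmf.prob (queries A) {qs. S \<in> captured a (set qs)}"
    by (subst fst[symmetric]) simp
  finally show ?thesis .
qed

text \<open>The sum is the expected number of members of \<open>F\<close> captured by the queries,
  which is at most the number of distinct queries for every outcome.\<close>

lemma sum_prob_captured_le:
  assumes "queries_domain (2 ^ a) A" "makes_at_most A q" "finite F"
  shows "(\<Sum>S\<in>F. measure_pmf.prob (queries A) {qs. S \<in> captured a (set qs)}) \<le> real q"
proof -
  let ?E = "\<lambda>S. {qs. S \<in> captured a (set qs)}"
  have int: "integrable (measure_pmf (queries A)) (indicat_real (?E S))" for S
    by (rule measure_pmf.integrable_const_bound[where B = 1]) (auto simp: indicator_def)
  have "(\<Sum>S\<in>F. measure_pmf.prob (queries A) (?E S))
    = measure_pmf.expectation (queries A) (\<lambda>qs. \<Sum>S\<in>F. indicator (?E S) qs)"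
    using int by (subst Bochner_Integration.integral_sum) auto
  also have "\<dots> \<le> real q"
  proof (rule measure_pmf.integral_le_const)
    show "integrable (measure_pmf (queries A)) (\<lambda>qs. \<Sum>S\<in>F. indicat_real (?E S) qs)"
      using int by (intro Bochner_Integration.integrable_sum)
    show "AE qs in measure_pmf (queries A). (\<Sum>S\<in>F. indicat_real (?E S) qs) \<le> real q"
    proof (rule AE_pmfI)
      fix qs assume qs: "qs \<in> set_pmf (queries A)"
      have "(\<Sum>S\<in>F. indicat_real (?E S) qs) = real (card (F \<inter> captured a (set qs)))"
        using assms(3) by (simp add: indicator_def sum.If_cases Int_def)
      also have "\<dots> \<le> real (card (captured a (set qs)))"
        by (simp add: card_mono)
      also have "\<dots> \<le> real (card (set qs))"
        using card_captured_le[of "set qs" a] assms(1) qs by (simp add: queries_domain_def)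
      also have "\<dots> \<le> real q"
        using card_length[of qs] assms(2) qs by (fastforce simp: makes_at_most_def)
      finally show "(\<Sum>S\<in>F. indicat_real (?E S) qs) \<le> real q" .
    qed
  qed
  finally show ?thesis .
qed

lemma query_lower_bound_power_two:
  "query_lower_bound (2 ^ a) (2 ^ b) (1 / 2 ^ b) p (p * real (a choose b))"
  unfolding query_lower_bound_def
proof (intro allI impI, elim conjE)
  fix A q
  assume A: "queries_domain (2 ^ a) A" "makes_at_most A q" "finds_monotone (2 ^ a) (2 ^ b) (1 / 2 ^ b) p A"
  \<comment> \<open>One hard input \<open>flip a S\<close> for each choice of \<open>b\<close> bits;
    each contributes success probability at least \<open>p\<close>.\<close>
  define F where "F = {S. S \<subseteq> {..<a} \<and> card S = b}"
  have "p * real (a choose b) = (\<Sum>S\<in>F. p)"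
    using n_subsets[of "{..<a}" b] by (simp add: F_def)
  also have "\<dots> \<le> (\<Sum>S\<in>F. measure_pmf.prob (queries A) {qs. S \<in> captured a (set qs)})"
  proof (rule sum_mono)
    fix S assume "S \<in> F"
    then have S: "S \<subseteq> {..<a}" "card S = b" by (auto simp: F_def)
    then have "p \<le> success_prob (2 ^ a) (2 ^ card S) A (flip a S)"
      using A(3) far_from_free_flip[OF S(1)] by (simp add: finds_monotone_def)
    then show "p \<le> measure_pmf.prob (queries A) {qs. S \<in> captured a (set qs)}"
      using success_prob_flip_le[OF S(1)] by (rule order_trans)
  qed
  also have "\<dots> \<le> real q"
    by (rule sum_prob_captured_le[OF A(1,2)]) (simp add: F_def)
  finally show "p * real (a choose b) \<le> real q" .
qed

theorem theorem4p1:
  fixes k n :: nat and p :: real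
  assumes "k \<le> n"
    and "\<exists>b. k = 2 ^ b"
    and "\<exists>a. n = 2 ^ a"
    and "0 < p" and "p < 1"
  shows "(\<exists>\<epsilon>\<^sub>0 > 0. query_lower_bound n k \<epsilon>\<^sub>0 p
            (p * real (nat \<lfloor>log 2 (real n)\<rfloor> choose nat \<lfloor>log 2 (real k)\<rfloor>)))
       \<and> query_lower_bound n k (1 / real k) p
            (p * real (nat \<lfloor>log 2 (real n)\<rfloor> choose nat \<lfloor>log 2 (real k)\<rfloor>))"
proof -
  obtain a b where ab: "n = 2 ^ a" "k = 2 ^ b" using assms(2,3) by auto
  \<comment> \<open>On powers of two the floor is exact, so the binomial coefficient in the claim is
    \<open>a choose b\<close>.\<close>
  have log: "nat \<lfloor>log 2 (real (2 ^ m))\<rfloor> = m" for m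
    by (simp add: log_nat_power)
  have bound: "query_lower_bound n k (1 / real k) p
      (p * real (nat \<lfloor>log 2 (real n)\<rfloor> choose nat \<lfloor>log 2 (real k)\<rfloor>))"
    using query_lower_bound_power_two[of a b p] unfolding ab log by simp
  moreover have "0 < 1 / real k" using ab by simp
  ultimately show ?thesis by blast
qed

end
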